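(* Let $F$ be a field, $m\ge 1$, $I=\{1,\dots,m\}$. For each associative binary operation $a\in\mathcal O_m$ on $I$, the algebra $\mathfrak C_a$ of cubic matrices over $F$ is accompanied; that is, there exists a surjective algebra homomorphism from $\mathfrak C_a$ onto the accompanying algebra $\mathfrak A$.
   Context: $\mathcal O_m$ denotes the set of all associative binary operations $a\colon I\times I\to I$. $\mathfrak C$ is the $m^3$-dimensional $F$-vector space of cubic matrices $A=(a_{ijk})_{i,j,k=1}^m$ with entries in $F$ (entrywise addition and scalar multiplication), with standard basis $E_{ijk}$, $i,j,k\in I$ (the $(i,j,k)$ entry of $E_{ijk}$ is $1$ and all others are $0$). For $a\in\mathcal O_m$, the multiplication $*_a$ on $\mathfrak C$ is the bilinear extension of $$E_{ijk}*_aE_{lnr}=\delta_{kl}\,E_{i\,a(j,n)\,r},$$ where $\delta_{kl}$ is the Kronecker symbol, and $\mathfrak C_a=(\mathfrak C,*_a)$. The accompanying algebra $\mathfrak A$ is the $m^2$-dimensional $F$-algebra with basis $\{\eta_{ij}: i,j\in I\}$ and multiplication table $\eta_{ij}\eta_{kl}=\delta_{jk}\eta_{il}$. An algebra is called accompanied if it admits a homomorphism (linear multiplicative map) onto $\mathfrak A$. *)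

theory Defs
  imports "HOL-Analysis.Cartesian_Space"
begin

text \<open>
  The index set \<open>I\<close> with \<open>m \<ge> 1\<close> elements is the universe of a type \<open>'i\<close> of class \<open>finite\<close>,
  so \<open>m = CARD('i)\<close>. Cubic matrices are vectors indexed by triples, square ones by pairs; the
  \<open>F\<close>-vector space structure is the library's componentwise \<open>+\<close> and scaling \<open>*s\<close>. The standard
  basis vector with index \<open>p\<close> is \<open>axis p 1\<close>.
\<close>

type_synonym ('f, 'i) cubic = "'f ^ ('i \<times> 'i \<times> 'i)"
type_synonym ('f, 'i) square = "'f ^ ('i \<times> 'i)"

definition assoc_ops :: "('i::finite \<Rightarrow> 'i \<Rightarrow> 'i) set"
  where "assoc_ops = {a. semigroup a}"

definition E :: "'i::finite \<Rightarrow> 'i \<Rightarrow> 'i \<Rightarrow> ('f::field, 'i) cubic"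
  where "E i j k = axis (i, j, k) 1"

definition eta :: "'i::finite \<Rightarrow> 'i \<Rightarrow> ('f::field, 'i) square"
  where "eta i j = axis (i, j) 1"

definition bilinear_ext ::
    "('b::finite \<Rightarrow> 'b \<Rightarrow> 'f::field ^ 'b) \<Rightarrow> 'f ^ 'b \<Rightarrow> 'f ^ 'b \<Rightarrow> 'f ^ 'b"
  where "bilinear_ext t x y = (\<Sum>p\<in>UNIV. \<Sum>q\<in>UNIV. (x $ p * y $ q) *s t p q)"

definition cubic_mult ::
    "('i::finite \<Rightarrow> 'i \<Rightarrow> 'i) \<Rightarrow> ('f::field, 'i) cubic \<Rightarrow> ('f, 'i) cubic \<Rightarrow> ('f, 'i) cubic"
  where "cubic_mult a =
    bilinear_ext (\<lambda>(i, j, k) (l, n, r). if k = l then E i (a j n) r else 0)"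

definition acc_mult ::
    "('f::field, 'i::finite) square \<Rightarrow> ('f, 'i) square \<Rightarrow> ('f, 'i) square"
  where "acc_mult = bilinear_ext (\<lambda>(i, j) (k, l). if j = k then eta i l else 0)"

definition algebra_hom ::
    "('f::field \<Rightarrow> 'v::ab_group_add \<Rightarrow> 'v) \<Rightarrow> ('v \<Rightarrow> 'v \<Rightarrow> 'v) \<Rightarrow>
     ('f \<Rightarrow> 'w::ab_group_add \<Rightarrow> 'w) \<Rightarrow> ('w \<Rightarrow> 'w \<Rightarrow> 'w) \<Rightarrow> ('v \<Rightarrow> 'w) \<Rightarrow> bool"
  where "algebra_hom s1 mult1 s2 mult2 h \<longleftrightarrow>
    Vector_Spaces.linear s1 s2 h \<and> (\<forall>x y. h (mult1 x y) = mult2 (h x) (h y))"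

text \<open>
  The accompanying algebra depends on the index set, which is passed as the type argument
  \<open>TYPE('i)\<close>.
\<close>

definition accompanied ::
    "'i::finite itself \<Rightarrow> ('f::field \<Rightarrow> 'v::ab_group_add \<Rightarrow> 'v) \<Rightarrow> ('v \<Rightarrow> 'v \<Rightarrow> 'v) \<Rightarrow> bool"
  where "accompanied (_ :: 'i itself) s mult \<longleftrightarrow>
    (\<exists>h :: 'v \<Rightarrow> ('f, 'i) square. algebra_hom s mult (*s) acc_mult h \<and> surj h)"

lemma bilinear_ext_axis:
  "bilinear_ext t (axis p 1) (axis q 1) = t p q"
proof -
  have "bilinear_ext t (axis p 1) (axis q 1) =
      (\<Sum>p'\<in>UNIV. \<Sum>q'\<in>UNIV. if q' = q then (if p' = p then t p q else 0) else 0)"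
    unfolding bilinear_ext_def by (intro sum.cong refl) (auto simp: axis_def)
  then show ?thesis by simp
qed

lemma bilinear_ext_add:
  "bilinear_ext t (x + x') y = bilinear_ext t x y + bilinear_ext t x' y"
  "bilinear_ext t x (y + y') = bilinear_ext t x y + bilinear_ext t x y'"
  by (simp_all add: bilinear_ext_def algebra_simps vec.scale_left_distrib sum.distrib)

lemma bilinear_ext_scale:
  "bilinear_ext t (c *s x) y = c *s bilinear_ext t x y"
  "bilinear_ext t x (c *s y) = c *s bilinear_ext t x y"
  by (simp_all add: bilinear_ext_def vec.scale_sum_right mult_ac)

lemma cubic_mult_E:
  "cubic_mult a (E i j k) (E l n r) = (if k = l then E i (a j n) r else 0)"
  by (simp add: cubic_mult_def E_def[of i j k] E_def[of l n r] bilinear_ext_axis)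

lemma acc_mult_eta:
  "acc_mult (eta i j) (eta k l) = (if j = k then eta i l else 0)"
  by (simp add: acc_mult_def eta_def[of i j] eta_def[of k l] bilinear_ext_axis)

end

theory Submission
  imports Defs
begin

text \<open>
  Forget the middle index: the linear map with \<open>E i j k \<mapsto> eta i k\<close> sends a cubic matrix to the
  square matrix of its sums over the middle index. In \<open>E i j k * E l n r\<close> the operation \<open>a\<close> affects
  only the middle index of the result, while the outer indices multiply as matrix units do,
  so the map is multiplicative on the standard basis and, by bilinearity, everywhere
  (\<open>linear_bilinear_ext\<close>). It is onto because a square matrix can be placed in a single layer of
  constant middle index.
\<close>

lemma linear_bilinear_ext_left:
  "Vector_Spaces.linear (*s) (*s) (\<lambda>x. bilinear_ext t x y)"
  by (simp add: Vector_Spaces.linear_iff vec.vector_space_axioms bilinear_ext_add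
      bilinear_ext_scale)

lemma linear_bilinear_ext_right:
  "Vector_Spaces.linear (*s) (*s) (\<lambda>y. bilinear_ext t x y)"
  by (simp add: Vector_Spaces.linear_iff vec.vector_space_axioms bilinear_ext_add
      bilinear_ext_scale)

text \<open>
  A linear map between algebras given by multiplication tables is multiplicative as soon as it is so
  on the standard basis: by bilinearity, both sides of the claim have the same coefficients
  \<open>x $ p * y $ q\<close> when \<open>x\<close> and \<open>y\<close> are expanded in that basis.
\<close>

lemma linear_bilinear_ext:
  fixes h :: "'f::field ^ 'b::finite \<Rightarrow> 'f ^ 'c::finite"
  assumes h: "Vector_Spaces.linear (*s) (*s) h"
    and basis: "\<And>p q. h (t p q) = bilinear_ext u (h (axis p 1)) (h (axis q 1))"
  shows "h (bilinear_ext t x y) = bilinear_ext u (h x) (h y)"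
proof -
  interpret h: Vector_Spaces.linear "(*s)" "(*s)" h by (fact h)
  have expand: "h z = (\<Sum>p\<in>UNIV. z $ p *s h (axis p 1))" for z
    by (subst basis_expansion[of z, symmetric]) (simp only: h.sum h.scale)
  interpret l: Vector_Spaces.linear "(*s)" "(*s)" "\<lambda>v. bilinear_ext u v w" for w
    by (fact linear_bilinear_ext_left)
  interpret r: Vector_Spaces.linear "(*s)" "(*s)" "\<lambda>w. bilinear_ext u v w" for v
    by (fact linear_bilinear_ext_right)
  have "h (bilinear_ext t x y) = (\<Sum>p\<in>UNIV. \<Sum>q\<in>UNIV.
      (x $ p * y $ q) *s bilinear_ext u (h (axis p 1)) (h (axis q 1)))"
    by (simp add: bilinear_ext_def[of t] h.sum h.scale basis)
  also have "\<dots> = bilinear_ext u (h x) (h y)"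
    by (subst sum.swap)
      (simp add: expand[of x] expand[of y] l.sum l.scale r.sum r.scale vec.scale_sum_right
        mult.commute)
  finally show ?thesis .
qed

definition sum_middle :: "('f::field, 'i::finite) cubic \<Rightarrow> ('f, 'i) square"
  where "sum_middle A = (\<chi> p. \<Sum>j\<in>UNIV. A $ (fst p, j, snd p))"

lemma linear_sum_middle: "Vector_Spaces.linear (*s) (*s) sum_middle"
  by (simp add: Vector_Spaces.linear_iff vec.vector_space_axioms sum_middle_def vec_eq_iff
      sum.distrib sum_distrib_left)

lemma sum_middle_E:
  "sum_middle (E i j k :: ('f::field, 'i::finite) cubic) = eta i k"
proof -
  have "(\<Sum>j'\<in>UNIV. (E i j k :: ('f, 'i) cubic) $ (i', j', k')) =
      (\<Sum>j'\<in>UNIV. if j' = j then (eta i k :: ('f, 'i) square) $ (i', k') else 0)"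
    for i' k'
    by (intro sum.cong refl) (auto simp: E_def eta_def axis_def)
  then show ?thesis by (simp add: sum_middle_def vec_eq_iff)
qed

lemma sum_middle_cubic_mult:
  fixes x y :: "('f::field, 'i::finite) cubic"
  shows "sum_middle (cubic_mult a x y) = acc_mult (sum_middle x) (sum_middle y)"
  unfolding cubic_mult_def acc_mult_def
proof (rule linear_bilinear_ext[OF linear_sum_middle], fold acc_mult_def)
  fix p q :: "'i \<times> 'i \<times> 'i"
  obtain i j k l n r where p: "p = (i, j, k)" and q: "q = (l, n, r)"
    by (metis prod_cases3)
  have zero: "sum_middle 0 = (0 :: ('f, 'i) square)"
    by (simp add: sum_middle_def vec_eq_iff)
  show "sum_middle ((case p of (i, j, k) \<Rightarrow> \<lambda>(l, n, r). if k = l then E i (a j n) r else 0) q) =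
      acc_mult (sum_middle (axis p 1)) (sum_middle (axis q 1) :: ('f, 'i) square)"
    by (simp add: p q zero sum_middle_E acc_mult_eta flip: E_def)
qed

lemma surj_sum_middle: "surj sum_middle"
proof (rule surjI)
  fix B :: "('f::field, 'i::finite) square"
  \<comment> \<open>Here \<open>undefined\<close> is an arbitrary fixed element of the nonempty index set.\<close>
  show "sum_middle (vec_lambda (\<lambda>(i, j, k). if j = undefined then B $ (i, k) else 0)) = B"
    by (simp add: sum_middle_def vec_eq_iff)
qed

theorem theorem5p4:
  fixes a :: "'i::finite \<Rightarrow> 'i \<Rightarrow> 'i"
  assumes "a \<in> assoc_ops"
  shows "accompanied TYPE('i) (*s)
    (cubic_mult a :: ('f::field, 'i) cubic \<Rightarrow> ('f, 'i) cubic \<Rightarrow> ('f, 'i) cubic)"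
  unfolding accompanied_def algebra_hom_def
  using linear_sum_middle sum_middle_cubic_mult surj_sum_middle by blast

end
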